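(* Suppose the standing assumptions on (P) and on the core function $K$ listed in the context hold. Let $\{w^k\}=\{(u^k,p^k)\}$ be generated by VAPP with $0<\underline{\epsilon}\le\epsilon^{k+1}\le\epsilon^k\le\overline{\epsilon}<\beta/(B_G+B_\Omega+\gamma\tau^2)$ for all $k$, and suppose it converges to $w^*\in\mathbf S^*$ and satisfies the VAPP-iteration-based error bound condition: there exist $c_1>0$ and $\eta>0$ such that $$\mathrm{dist}(w^{k+1},\mathbf S^* )\le c_1\|w^k-w^{k+1}\|\quad\text{whenever } \|w^{k+1}-w^*\|\le\eta .$$ Then there exists $\theta\in(0,1)$ such that $$\mathrm{dist}^2_{D,\epsilon^{k+1}}(w^{k+1},\mathbf S^* )\le\theta\cdot\mathrm{dist}^2_{D,\epsilon^k}(w^k,\mathbf S^* )\qquad\text{for all }k.$$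
   Context: Norms are Euclidean. $\mathbf U\subset\mathbb R^n$ is a nonempty closed convex set; $\mathbf C\subset\mathbb R^m$ is a nonempty closed convex cone with vertex at the origin; $\mathbf C^*=\{y:\langle y,x\rangle\ge0\ \forall x\in\mathbf C\}$; $\Pi$ is the Euclidean projection onto $\mathbf C^*$. Problem (P): minimize $G(u)+J(u)$ subject to $\Theta(u)=\Omega(u)+\Phi(u)\in-\mathbf C$, $u\in\mathbf U$, where $\Omega,\Phi$ map into $\mathbb R^m$. Lagrangian: $L(u,p)=(G+J)(u)+\langle p,\Theta(u)\rangle$. A saddle point of $L$ over $\mathbf U\times\mathbf C^*$ is $(u^*,p^* )\in\mathbf U\times\mathbf C^*$ with $L(u^*,p)\le L(u^*,p^* )\le L(u,p^* )$ for all $u\in\mathbf U,p\in\mathbf C^*$. $\mathbf S^*$ is the set of saddle points. Standing assumptions on (P): (H1) $J$ is a convex l.s.c. function (not necessarily differentiable) with $\operatorname{dom}J\cap\mathbf U\ne\emptyset$. (H2) $G$ is convex and differentiable, with derivative Lipschitz with constant $B_G$. (H3) $\Omega$ and $\Phi$ are $\mathbf C$-convex on $\mathbf U$, where $F$ is $\mathbf C$-convex if $F(\alpha u+(1-\alpha)v)-\alpha F(u)-(1-\alpha)F(v)\in-\mathbf C$ for all $u,v\in\mathbf U$, $\alpha\in[0,1]$. (H4) $\Omega$ is differentiable and for every $p\in\mathbb R^m$ the function $f_p(u)=\langle p,\Omega(u)\rangle$ satisfies $\|\nabla f_p(u)-\nabla f_p(v)\|\le B_\Omega\|u-v\|$ for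 all $u,v\in\mathbf U$, with $B_\Omega$ independent of $p$. (H5) $\Theta$ is Lipschitz with constant $\tau$ on an open set containing $\mathbf U$. (H6) If the interior $\mathring{\mathbf C}\neq\emptyset$, then $\Theta(\mathbf U)\cap(-\mathring{\mathbf C})\ne\emptyset$; if $\mathbf C=\{0\}$, then $0$ is in the interior of $\Theta(\mathbf U)$. (H7) $L$ has at least one saddle point over $\mathbf U\times\mathbf C^*$. Assumption on the core function: $K$ is strongly convex with parameter $\beta>0$ and differentiable with gradient Lipschitz with constant $B$ on $\mathbf U$. Put $D(u,v)=K(u)-K(v)-\langle\nabla K(v),u-v\rangle$. VAPP: fix $\gamma>0$, positive parameters $\epsilon^k$, $u^0\in\mathbf U$, $p^0\in\mathbf C^*$. For $k=0,1,\dots$, with $q^k=\Pi(p^k+\gamma\Theta(u^k))$, set $$u^{k+1}=\arg\min_{u\in\mathbf U}\langle\nabla G(u^k),u\rangle+J(u)+\langle q^k,\nabla\Omega(u^k)u+\Phi(u)\rangle+\tfrac1{\epsilon^k}D(u,u^k),\qquad p^{k+1}=\Pi(p^k+\gamma\Theta(u^{k+1})).$$ Distances: for $w=(u,p)$, $$\mathrm{dist}_{D,\epsilon^k}(w,\mathbf S^* )=\min_{(u^*,p^* )\in\mathbf S^*}\Big[D(u^*,u)+\frac{\epsilon^k}{2\gamma}\|p-p^*\|^2\Big]^{1/2},\qquad \mathrm{dist}(w,\mathbf S^* )=\min_{(u^*,p^* )\in\mathbf S^*}\big[\|u-u^*\|^2+\|p-p^*\|^2\big]^{1/2}.$$ 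*)

theory Defs
  imports "HOL-Analysis.Analysis"
begin

definition grad :: "('a::euclidean_space \<Rightarrow> real) \<Rightarrow> 'a \<Rightarrow> 'a" where
  "grad f x = (THE g. GDERIV f x :> g)"

lemma grad_eqI:
  assumes "GDERIV f x :> g"
  shows "grad f x = g"
  unfolding grad_def
proof (rule the_equality)
  show "GDERIV f x :> g" by fact
next
  fix g' assume "GDERIV f x :> g'"
  then have "(\<lambda>h. h \<bullet> g') = (\<lambda>h. h \<bullet> g)"
    using assms unfolding gderiv_def by (rule has_derivative_unique)
  then have "(g' - g) \<bullet> g' = (g' - g) \<bullet> g"
    by (rule fun_cong)
  then have "(g' - g) \<bullet> (g' - g) = 0"
    by (simp add: inner_diff_right)
  then show "g' = g"
    by simp
qed

lemma gderiv_grad: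
  assumes "f differentiable (at x)"
  shows "GDERIV f x :> grad f x"
proof -
  obtain f' where f': "(f has_derivative f') (at x)"
    using assms unfolding differentiable_def by blast
  interpret linear f'
    using f' has_derivative_linear by blast
  have "f' h = h \<bullet> (\<Sum>b\<in>Basis. f' b *\<^sub>R b)" for h
  proof -
    have "f' h = f' (\<Sum>b\<in>Basis. (h \<bullet> b) *\<^sub>R b)"
      by (simp add: euclidean_representation)
    also have "\<dots> = h \<bullet> (\<Sum>b\<in>Basis. f' b *\<^sub>R b)"
      by (simp add: sum scale inner_sum_right mult.commute)
    finally show ?thesis .
  qed
  then have "f' = (\<lambda>h. h \<bullet> (\<Sum>b\<in>Basis. f' b *\<^sub>R b))"
    by (rule ext)
  with f' have "GDERIV f x :> (\<Sum>b\<in>Basis. f' b *\<^sub>R b)"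
    by (simp add: gderiv_def)
  with grad_eqI[OF this] show ?thesis
    by simp
qed

definition strongly_convex_on :: "real \<Rightarrow> 'a::euclidean_space set \<Rightarrow> ('a \<Rightarrow> real) \<Rightarrow> bool" where
  "strongly_convex_on \<beta> S f \<longleftrightarrow> convex S \<and>
     (\<forall>x\<in>S. \<forall>y\<in>S. \<forall>t\<in>{0..1}.
        f (t *\<^sub>R x + (1 - t) *\<^sub>R y)
          \<le> t * f x + (1 - t) * f y - \<beta> / 2 * t * (1 - t) * (norm (x - y))\<^sup>2)"

text \<open>Functions with values in the reals extended by plus infinity only. In \<^typ>\<open>ereal\<close>,
  0 times infinity is 0, so the convexity inequality is trivial for t = 0 and t = 1, as it
  should be.\<close>

definition ext_convex :: "('a::euclidean_space \<Rightarrow> ereal) \<Rightarrow> bool" where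
  "ext_convex f \<longleftrightarrow> (\<forall>x. f x \<noteq> -\<infinity>) \<and>
     (\<forall>x y. \<forall>t\<in>{0..1}. f (t *\<^sub>R x + (1 - t) *\<^sub>R y) \<le> ereal t * f x + ereal (1 - t) * f y)"

definition lower_semicontinuous :: "('a::euclidean_space \<Rightarrow> ereal) \<Rightarrow> bool" where
  "lower_semicontinuous f \<longleftrightarrow> (\<forall>x. f x \<le> Liminf (at x) f)"

definition ext_dom :: "('a \<Rightarrow> ereal) \<Rightarrow> 'a set" where
  "ext_dom f = {x. f x < \<infinity>}"

definition dual_cone :: "'b::euclidean_space set \<Rightarrow> 'b set" where
  "dual_cone C = {y. \<forall>x\<in>C. 0 \<le> y \<bullet> x}"

definition cone_convex_on ::
  "'b::euclidean_space set \<Rightarrow> 'a::euclidean_space set \<Rightarrow> ('a \<Rightarrow> 'b) \<Rightarrow> bool" where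
  "cone_convex_on C U F \<longleftrightarrow>
     (\<forall>u\<in>U. \<forall>v\<in>U. \<forall>t\<in>{0..1}.
        F (t *\<^sub>R u + (1 - t) *\<^sub>R v) - t *\<^sub>R F u - (1 - t) *\<^sub>R F v \<in> uminus ` C)"

definition lagrangian ::
  "('a::euclidean_space \<Rightarrow> real) \<Rightarrow> ('a \<Rightarrow> ereal) \<Rightarrow> ('a \<Rightarrow> 'b::euclidean_space) \<Rightarrow> 'a \<Rightarrow> 'b \<Rightarrow> ereal" where
  "lagrangian G J \<Theta> u p = ereal (G u) + J u + ereal (p \<bullet> \<Theta> u)"

definition saddle_points :: "('a \<Rightarrow> 'b \<Rightarrow> ereal) \<Rightarrow> 'a set \<Rightarrow> 'b set \<Rightarrow> ('a \<times> 'b) set" where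
  "saddle_points L U P =
     {(us, ps). us \<in> U \<and> ps \<in> P \<and> (\<forall>p\<in>P. L us p \<le> L us ps) \<and> (\<forall>u\<in>U. L us ps \<le> L u ps)}"

definition bregman :: "('a::euclidean_space \<Rightarrow> real) \<Rightarrow> 'a \<Rightarrow> 'a \<Rightarrow> real" where
  "bregman K u v = K u - K v - grad K v \<bullet> (u - v)"

text \<open>The iterates are \<open>w k = (u\<^sup>k, p\<^sup>k)\<close>.\<close>

definition vapp_sequence ::
  "'a::euclidean_space set \<Rightarrow> 'b::euclidean_space set \<Rightarrow> ('a \<Rightarrow> real) \<Rightarrow> ('a \<Rightarrow> ereal) \<Rightarrow>
   ('a \<Rightarrow> 'b) \<Rightarrow> ('a \<Rightarrow> 'b) \<Rightarrow> ('a \<Rightarrow> real) \<Rightarrow> real \<Rightarrow> (nat \<Rightarrow> real) \<Rightarrow> (nat \<Rightarrow> 'a \<times> 'b) \<Rightarrow> bool" where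
  "vapp_sequence U C G J \<Omega> \<Phi> K \<gamma> \<epsilon> w \<longleftrightarrow>
     w 0 \<in> U \<times> dual_cone C \<and>
     (\<forall>k. let \<Theta> = (\<lambda>u. \<Omega> u + \<Phi> u);
              uk = fst (w k);
              pk = snd (w k);
              qk = closest_point (dual_cone C) (pk + \<gamma> *\<^sub>R \<Theta> uk)
          in is_arg_min
               (\<lambda>u. ereal (grad G uk \<bullet> u) + J u
                    + ereal (qk \<bullet> (frechet_derivative \<Omega> (at uk) u + \<Phi> u))
                    + ereal (1 / \<epsilon> k * bregman K u uk))
               (\<lambda>u. u \<in> U) (fst (w (Suc k))) \<and>
             snd (w (Suc k)) = closest_point (dual_cone C) (pk + \<gamma> *\<^sub>R \<Theta> (fst (w (Suc k)))))"

text \<open>The infimum is a minimum when \<open>S\<close> is nonempty and closed, as is the set of saddle points,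
  and \<open>K\<close> is strongly convex. The unweighted distance needs no definition: the library's product norm is
  Euclidean, so it is \<^const>\<open>infdist\<close>.\<close>

definition bregman_dist ::
  "('a::euclidean_space \<Rightarrow> real) \<Rightarrow> real \<Rightarrow> real \<Rightarrow> 'a \<times> 'b::euclidean_space \<Rightarrow> ('a \<times> 'b) set \<Rightarrow> real" where
  "bregman_dist K \<gamma> \<epsilon> w S =
     (INF (us, ps)\<in>S. sqrt (bregman K us (fst w) + \<epsilon> / (2 * \<gamma>) * (norm (snd w - ps))\<^sup>2))"

end

theory Submission
  imports Defs
begin

text \<open>
  Measure the distance of \<open>w = (u, p)\<close> to a saddle point \<open>s = (us, ps)\<close> by the energy
  \<open>bregman K us u + \<epsilon> / (2 * \<gamma>) * (norm (p - ps))\<^sup>2\<close>. The heart of the matter is that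
  one iteration \<open>w \<mapsto> w'\<close> decreases the energy with respect to every saddle point by at least
  \<open>\<kappa> * (norm (w - w'))\<^sup>2\<close>, where \<open>\<kappa> > 0\<close> depends neither on the iteration nor on the
  saddle point (\<open>energy_sufficient_decrease\<close>). As the parameters \<open>\<epsilon>\<close> do not increase, taking the
  infimum over the saddle points turns this into \<open>a (Suc k) \<le> a k - \<kappa> * r k\<close>, where \<open>a k\<close> is the
  squared Bregman distance of the \<open>k\<close>-th iterate and \<open>r k\<close> the squared length of the \<open>k\<close>-th step.

  The decrease arises as follows. The optimality condition for \<open>u'\<close>, tested at \<open>us\<close>, and the
  three-point identity bound the change of the Bregman term by the change of the linearized
  objective between \<open>u'\<close> and \<open>us\<close>. Convexity at \<open>us\<close> and the descent lemma at \<open>u'\<close> replace the linearization by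
  the Lagrangian at the predicted multiplier \<open>q\<close>, and the saddle inequalities leave only
  \<open>(ps - q) \<bullet> \<Theta> u'\<close>. The obtuse-angle property of the two projections that produce \<open>q\<close> and \<open>p'\<close> converts
  this term into the change of \<open>(norm (p - ps))\<^sup>2\<close> and a gain \<open>(norm (q - p))\<^sup>2\<close>. What is paid on
  the way are multiples of \<open>(norm (u' - u))\<^sup>2\<close> that add up to
  \<open>\<epsilon> * (B\<^sub>G + B\<^sub>\<Omega> + \<gamma> * \<tau>\<^sup>2) / 2\<close>, which strong convexity of \<open>K\<close> outweighs
  precisely under the bound on \<open>\<epsilon>\<close>.

  In the other direction the energy is at most \<open>M * (norm (w - s))\<^sup>2\<close>, so close to the limit the error
  bound gives \<open>a (Suc k) \<le> M * c\<^sub>1\<^sup>2 * r k\<close>. Eliminating \<open>r k\<close> yields a contraction factor for all large \<open>k\<close>.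
  The error bound is silent about the finitely many iterates far from the limit. For each of
  them, either the iteration moves, and then the decrease is strict, or it is stationary, and then
  the iterate already is a saddle point (\<open>fixed_point_imp_saddle\<close>) and \<open>a k = 0\<close>. So the maximum
  of finitely many ratios below \<open>1\<close> completes the factor (\<open>uniform_contraction_factor\<close>).
\<close>

section \<open>Gradient inequalities on a convex set\<close>

text \<open>A bound on the increments along a segment, linear in \<open>t\<close> up to a quadratic error, passes to the
  directional derivative. This single limit serves the gradient inequality of convex functions, its
  strongly convex version (where the error is genuinely quadratic) and first-order optimality.\<close>

lemma gderiv_le_of_quadratic_bound:
  fixes f :: "'a::euclidean_space \<Rightarrow> real"
  assumes der: "GDERIV f x :> g"
    and bound: "\<And>t. 0 < t \<Longrightarrow> t < 1 \<Longrightarrow> f (x + t *\<^sub>R h) - f x \<le> t * c + t\<^sup>2 * m"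
  shows "g \<bullet> h \<le> c"
proof -
  have "((\<lambda>t. f (x + t *\<^sub>R h)) has_derivative (\<lambda>s. (s *\<^sub>R h) \<bullet> g)) (at 0)"
  proof (rule has_derivative_compose[where g = f and f = "\<lambda>t. x + t *\<^sub>R h"])
    show "((\<lambda>t. x + t *\<^sub>R h) has_derivative (\<lambda>s. s *\<^sub>R h)) (at 0)"
      by (auto intro!: derivative_eq_intros)
    show "(f has_derivative (\<lambda>k. k \<bullet> g)) (at (x + 0 *\<^sub>R h))"
      using der by (simp add: gderiv_def)
  qed
  then have "((\<lambda>t. f (x + t *\<^sub>R h)) has_field_derivative (g \<bullet> h)) (at 0)"
    by (simp add: has_field_derivative_def inner_commute mult_commute_abs)
  then have "((\<lambda>t. (f (x + t *\<^sub>R h) - f x) / t) \<longlongrightarrow> g \<bullet> h) (at_right 0)"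
    by (auto simp: DERIV_def intro: filterlim_at_split[THEN iffD1, THEN conjunct2])
  moreover have "((\<lambda>t. c + t * m) \<longlongrightarrow> c + 0 * m) (at_right 0)"
    by (intro tendsto_intros)
  moreover have "\<forall>\<^sub>F t in at_right 0. (f (x + t *\<^sub>R h) - f x) / t \<le> c + t * m"
    unfolding eventually_at_right_field
  proof (intro exI[of _ 1] conjI allI impI)
    fix t :: real assume "0 < t" "t < 1"
    with bound[of t] show "(f (x + t *\<^sub>R h) - f x) / t \<le> c + t * m"
      by (simp add: field_simps power2_eq_square)
  qed simp
  ultimately show ?thesis
    using tendsto_le[of "at_right (0::real)"] by fastforce
qed

text \<open>Convexity bounds the increments along the segment from \<open>x\<close> to \<open>y\<close>, which stays in \<open>U\<close> even when
  \<open>x\<close> is a boundary point; this suffices for the derivative in the direction \<open>y - x\<close>.\<close>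

lemma convex_on_gradient_ineq:
  fixes f :: "'a::euclidean_space \<Rightarrow> real"
  assumes f: "convex_on U f" and der: "GDERIV f x :> g" and xy: "x \<in> U" "y \<in> U"
  shows "g \<bullet> (y - x) \<le> f y - f x"
proof (rule gderiv_le_of_quadratic_bound[OF der, where m = 0])
  fix t :: real assume t: "0 < t" "t < 1"
  have eq: "x + t *\<^sub>R (y - x) = (1 - t) *\<^sub>R x + t *\<^sub>R y"
    by (simp add: algebra_simps)
  have "f (x + t *\<^sub>R (y - x)) \<le> (1 - t) * f x + t * f y"
    unfolding eq using t by (intro convex_onD[OF f] xy) auto
  then show "f (x + t *\<^sub>R (y - x)) - f x \<le> t * (f y - f x) + t\<^sup>2 * 0"
    by (simp add: algebra_simps)
qed

text \<open>Moving from the minimizer \<open>x\<close> towards \<open>v\<close> by a fraction \<open>t\<close> changes the convex part \<open>\<phi>\<close>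
  by at most \<open>t * (\<phi> v - \<phi> x)\<close>, whereas the change of the smooth part \<open>d\<close> is given by its
  first-order term as \<open>t\<close> tends to zero.\<close>

lemma composite_minimizer_variational_ineq:
  fixes d \<phi> :: "'a::euclidean_space \<Rightarrow> real"
  assumes \<phi>: "convex_on U \<phi>" and der: "GDERIV d x :> g" and xv: "x \<in> U" "v \<in> U"
    and min: "\<And>y. y \<in> U \<Longrightarrow> \<phi> x + d x \<le> \<phi> y + d y"
  shows "0 \<le> \<phi> v - \<phi> x + g \<bullet> (v - x)"
proof -
  have "GDERIV (\<lambda>y. - d y) x :> - g"
    using der by (simp add: gderiv_def has_derivative_minus)
  then have "(- g) \<bullet> (v - x) \<le> \<phi> v - \<phi> x"
  proof (rule gderiv_le_of_quadratic_bound[where m = 0])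
    fix t :: real assume t: "0 < t" "t < 1"
    let ?y = "x + t *\<^sub>R (v - x)"
    have eq: "?y = (1 - t) *\<^sub>R x + t *\<^sub>R v"
      by (simp add: algebra_simps)
    have "?y \<in> U"
      unfolding eq using convex_on_imp_convex[OF \<phi>] t xv by (intro convexD) auto
    moreover have "\<phi> ?y \<le> (1 - t) * \<phi> x + t * \<phi> v"
      unfolding eq using t by (intro convex_onD[OF \<phi>] xv) auto
    ultimately show "- d ?y - - d x \<le> t * (\<phi> v - \<phi> x) + t\<^sup>2 * 0"
      using min[of ?y] by (simp add: algebra_simps)
  qed
  then show ?thesis by simp
qed

text \<open>This is the descent lemma. Subtracting the claimed upper bound along the segment leaves a
  function of \<open>t\<close> whose derivative is nonpositive by the Lipschitz condition.\<close>

lemma lipschitz_gradient_upper_bound: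
  fixes f :: "'a::euclidean_space \<Rightarrow> real"
  assumes U: "convex U" and diff: "\<And>u. u \<in> U \<Longrightarrow> f differentiable (at u)"
    and lip: "L-lipschitz_on U (grad f)" and xy: "x \<in> U" "y \<in> U"
  shows "f y \<le> f x + grad f x \<bullet> (y - x) + L / 2 * (norm (y - x))\<^sup>2"
proof -
  define h where "h = y - x"
  define r where "r t = f (x + t *\<^sub>R h) - t * (grad f x \<bullet> h) - L / 2 * t\<^sup>2 * (norm h)\<^sup>2" for t
  have "r 1 \<le> r 0"
  proof (rule DERIV_nonpos_imp_nonincreasing[of 0 1 r])
    fix t :: real assume t: "0 \<le> t" "t \<le> 1"
    let ?z = "x + t *\<^sub>R h"
    have "?z = (1 - t) *\<^sub>R x + t *\<^sub>R y"
      by (simp add: h_def algebra_simps)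
    then have zU: "?z \<in> U"
      using U t xy by (auto intro: convexD)
    have "((\<lambda>t. f (x + t *\<^sub>R h)) has_derivative (\<lambda>s. (s *\<^sub>R h) \<bullet> grad f ?z)) (at t)"
    proof (rule has_derivative_compose[where g = f and f = "\<lambda>t. x + t *\<^sub>R h"])
      show "((\<lambda>t. x + t *\<^sub>R h) has_derivative (\<lambda>s. s *\<^sub>R h)) (at t)"
        by (auto intro!: derivative_eq_intros)
      show "(f has_derivative (\<lambda>k. k \<bullet> grad f ?z)) (at ?z)"
        using gderiv_grad[OF diff[OF zU]] by (simp add: gderiv_def)
    qed
    then have "((\<lambda>t. f (x + t *\<^sub>R h)) has_field_derivative (grad f ?z \<bullet> h)) (at t)"
      by (simp add: has_field_derivative_def inner_commute mult_commute_abs)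
    then have "(r has_field_derivative
        (grad f ?z \<bullet> h - grad f x \<bullet> h - L * t * (norm h)\<^sup>2)) (at t)"
      unfolding r_def by (auto intro!: derivative_eq_intros)
    moreover have "grad f ?z \<bullet> h - grad f x \<bullet> h \<le> L * t * (norm h)\<^sup>2"
    proof -
      have "grad f ?z \<bullet> h - grad f x \<bullet> h = (grad f ?z - grad f x) \<bullet> h"
        by (simp add: inner_diff_left)
      also have "\<dots> \<le> norm (grad f ?z - grad f x) * norm h"
        by (rule norm_cauchy_schwarz)
      also have "\<dots> \<le> (L * (t * norm h)) * norm h"
        using lipschitz_onD[OF lip zU xy(1)] t
        by (intro mult_right_mono) (auto simp: dist_norm)
      finally show ?thesis by (simp add: power2_eq_square algebra_simps)
    qed
    ultimately show "\<exists>y. (r has_real_derivative y) (at t) \<and> y \<le> 0"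
      by (intro exI conjI) auto
  qed simp
  then show ?thesis by (simp add: r_def h_def)
qed

lemma bregman_three_point:
  "(grad K x' - grad K x) \<bullet> (z - x') = bregman K z x - bregman K z x' - bregman K x' x"
  by (simp add: bregman_def inner_diff_left inner_diff_right)

lemma bregman_self [simp]: "bregman K x x = 0"
  by (simp add: bregman_def)

lemma bregman_lower_bound:
  assumes K: "strongly_convex_on \<beta> U K" and diff: "K differentiable (at x)"
    and xy: "x \<in> U" "y \<in> U"
  shows "\<beta> / 2 * (norm (y - x))\<^sup>2 \<le> bregman K y x"
proof -
  let ?n = "(norm (y - x))\<^sup>2"
  have "grad K x \<bullet> (y - x) \<le> K y - K x - \<beta> / 2 * ?n"
  proof (rule gderiv_le_of_quadratic_bound[OF gderiv_grad[OF diff], where m = "\<beta> / 2 * ?n"])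
    fix t :: real assume t: "0 < t" "t < 1"
    have eq: "x + t *\<^sub>R (y - x) = t *\<^sub>R y + (1 - t) *\<^sub>R x"
      by (simp add: algebra_simps)
    have "K (x + t *\<^sub>R (y - x)) \<le> t * K y + (1 - t) * K x - \<beta> / 2 * t * (1 - t) * ?n"
      unfolding eq using K t xy by (auto simp: strongly_convex_on_def)
    then show "K (x + t *\<^sub>R (y - x)) - K x \<le> t * (K y - K x - \<beta> / 2 * ?n) + t\<^sup>2 * (\<beta> / 2 * ?n)"
      by (simp add: algebra_simps power2_eq_square diff_divide_distrib)
  qed
  then show ?thesis by (simp add: bregman_def)
qed

section \<open>Convex functions with values in the extended reals\<close>

lemma ext_convex_finite:
  assumes "ext_convex J" "x \<in> ext_dom J"
  shows "J x = ereal (real_of_ereal (J x))"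
  using assms by (cases "J x") (auto simp: ext_convex_def ext_dom_def)

text \<open>Restricted to its effective domain, a convex function with values in the extended reals is an
  ordinary real convex function. From here on all arguments are about real functions on
  \<open>U \<inter> ext_dom J\<close>.\<close>

lemma ext_convex_imp_convex_on:
  assumes J: "ext_convex J"
  shows "convex_on (ext_dom J) (\<lambda>x. real_of_ereal (J x))"
proof -
  have *: "t *\<^sub>R x + (1 - t) *\<^sub>R y \<in> ext_dom J \<and>
      real_of_ereal (J (t *\<^sub>R x + (1 - t) *\<^sub>R y))
        \<le> t * real_of_ereal (J x) + (1 - t) * real_of_ereal (J y)"
    if xy: "x \<in> ext_dom J" "y \<in> ext_dom J" and t: "t \<in> {0..1}" for x y t
  proof -
    let ?z = "t *\<^sub>R x + (1 - t) *\<^sub>R y"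
    have "J ?z \<le> ereal t * J x + ereal (1 - t) * J y"
      using J t by (simp add: ext_convex_def)
    also have "\<dots> = ereal (t * real_of_ereal (J x) + (1 - t) * real_of_ereal (J y))"
      by (subst (1 2) ext_convex_finite[OF J]) (use xy in auto)
    finally have le: "J ?z \<le> ereal (t * real_of_ereal (J x) + (1 - t) * real_of_ereal (J y))" .
    then have z: "?z \<in> ext_dom J"
      by (auto simp: ext_dom_def intro: le_less_trans)
    with le show ?thesis
      by (metis J ereal_less_eq(3) ext_convex_finite)
  qed
  have "convex (ext_dom J)"
    unfolding convex_alt
  proof (intro ballI allI impI)
    fix x y and t :: real
    assume "x \<in> ext_dom J" "y \<in> ext_dom J" "0 \<le> t \<and> t \<le> 1"
    with *[of y x t] show "(1 - t) *\<^sub>R x + t *\<^sub>R y \<in> ext_dom J"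
      by (simp add: add.commute)
  qed
  then show ?thesis
  proof (rule convex_onI[rotated])
    fix t :: real and x y assume "0 < t" "t < 1" "x \<in> ext_dom J" "y \<in> ext_dom J"
    with *[of y x t] show "real_of_ereal (J ((1 - t) *\<^sub>R x + t *\<^sub>R y))
        \<le> (1 - t) * real_of_ereal (J x) + t * real_of_ereal (J y)"
      by (simp add: add.commute)
  qed
qed

text \<open>Since \<open>J\<close> is finite somewhere on \<open>U\<close>, it is finite at the primal part of every saddle point, and
  points of \<open>U\<close> outside the effective domain impose no condition.\<close>

lemma saddle_points_lagrangian_iff:
  assumes J: "ext_convex J" and dom: "ext_dom J \<inter> U \<noteq> {}"
  shows "(x, y) \<in> saddle_points (lagrangian G J \<Theta>) U P \<longleftrightarrow>
    x \<in> U \<inter> ext_dom J \<and> y \<in> P \<and> (\<forall>p\<in>P. p \<bullet> \<Theta> x \<le> y \<bullet> \<Theta> x) \<and>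
    (\<forall>u\<in>U \<inter> ext_dom J. G x + real_of_ereal (J x) + y \<bullet> \<Theta> x
        \<le> G u + real_of_ereal (J u) + y \<bullet> \<Theta> u)"
    (is "?L \<longleftrightarrow> ?R")
proof -
  have L_fin: "lagrangian G J \<Theta> u p = ereal (G u + real_of_ereal (J u) + p \<bullet> \<Theta> u)"
    if "u \<in> ext_dom J" for u p
    unfolding lagrangian_def by (subst ext_convex_finite[OF J that]) simp
  have L_inf: "lagrangian G J \<Theta> u p = \<infinity>" if "u \<notin> ext_dom J" for u p
    using that by (simp add: lagrangian_def ext_dom_def)
  obtain u0 where u0: "u0 \<in> U" "u0 \<in> ext_dom J"
    using dom by blast
  show ?thesis
  proof
    assume l: ?L
    then have "lagrangian G J \<Theta> x y \<le> lagrangian G J \<Theta> u0 y"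
      using u0 by (auto simp: saddle_points_def)
    then have x: "x \<in> ext_dom J"
      by (rule contrapos_pp) (simp add: L_inf L_fin u0)
    show ?R
      using l x by (auto simp: saddle_points_def L_fin dest!: bspec)
  next
    assume r: ?R
    have "lagrangian G J \<Theta> x y \<le> lagrangian G J \<Theta> u y" if "u \<in> U" for u
      using r that by (cases "u \<in> ext_dom J") (auto simp: L_fin L_inf)
    with r show ?L
      by (auto simp: saddle_points_def L_fin)
  qed
qed

section \<open>The dual cone\<close>

lemma dual_cone_closed_convex:
  "closed (dual_cone C)" "convex (dual_cone C)" "0 \<in> dual_cone C"
proof -
  have eq: "dual_cone C = (\<Inter>x\<in>C. {y. x \<bullet> y \<ge> 0})"
    by (auto simp: dual_cone_def inner_commute)
  show "closed (dual_cone C)"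
    unfolding eq by (intro closed_INT ballI closed_halfspace_ge)
  show "convex (dual_cone C)"
    unfolding eq by (intro convex_INT convex_halfspace_ge)
  show "0 \<in> dual_cone C"
    by (simp add: dual_cone_def)
qed

text \<open>Pairing the convexity defect, an element of \<open>- C\<close>, with an element of the dual cone gives
  a nonpositive number.\<close>

lemma cone_convex_on_imp_convex_on:
  assumes F: "cone_convex_on C U F" and U: "convex U" and q: "q \<in> dual_cone C"
  shows "convex_on U (\<lambda>u. q \<bullet> F u)"
proof (rule convex_onI[OF _ U])
  fix t :: real and x y assume t: "0 < t" "t < 1" and xy: "x \<in> U" "y \<in> U"
  then have "F (t *\<^sub>R y + (1 - t) *\<^sub>R x) - t *\<^sub>R F y - (1 - t) *\<^sub>R F x \<in> uminus ` C"
    using F by (simp add: cone_convex_on_def)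
  then obtain c where c: "c \<in> C"
    "F (t *\<^sub>R y + (1 - t) *\<^sub>R x) - t *\<^sub>R F y - (1 - t) *\<^sub>R F x = - c"
    by blast
  have "q \<bullet> F (t *\<^sub>R y + (1 - t) *\<^sub>R x) - t * (q \<bullet> F y) - (1 - t) * (q \<bullet> F x) = - (q \<bullet> c)"
    using arg_cong[OF c(2), of "inner q"] by (simp add: inner_diff_right)
  moreover have "0 \<le> q \<bullet> c"
    using q c(1) by (simp add: dual_cone_def)
  ultimately show "q \<bullet> F ((1 - t) *\<^sub>R x + t *\<^sub>R y) \<le> (1 - t) * (q \<bullet> F x) + t * (q \<bullet> F y)"
    by (simp add: add.commute)
qed

lemma grad_inner_comp:
  assumes "\<Omega> differentiable (at u)"
  shows "GDERIV (\<lambda>u. q \<bullet> \<Omega> u) u :> grad (\<lambda>u. q \<bullet> \<Omega> u) u"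
    and "grad (\<lambda>u. q \<bullet> \<Omega> u) u \<bullet> h = q \<bullet> frechet_derivative \<Omega> (at u) h"
proof -
  have d: "((\<lambda>u. q \<bullet> \<Omega> u) has_derivative (\<lambda>h. q \<bullet> frechet_derivative \<Omega> (at u) h)) (at u)"
    using assms by (auto intro!: derivative_eq_intros simp: frechet_derivative_works)
  then show g: "GDERIV (\<lambda>u. q \<bullet> \<Omega> u) u :> grad (\<lambda>u. q \<bullet> \<Omega> u) u"
    by (intro gderiv_grad) (auto simp: differentiable_def)
  from has_derivative_unique[OF g[unfolded gderiv_def] d]
  show "grad (\<lambda>u. q \<bullet> \<Omega> u) u \<bullet> h = q \<bullet> frechet_derivative \<Omega> (at u) h"
    by (metis inner_commute)
qed

section \<open>One iteration\<close>

text \<open>The locale collects the hypotheses under which a single iteration can be analysed. The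
  parameter \<open>\<epsilon>\<close> and the iterates are arguments of the lemmas, because the constants obtained must be
  uniform in them.\<close>

locale vapp_problem =
  fixes U :: "'a::euclidean_space set" and C :: "'b::euclidean_space set"
    and G K :: "'a \<Rightarrow> real" and J :: "'a \<Rightarrow> ereal"
    and \<Omega> \<Phi> \<Theta> :: "'a \<Rightarrow> 'b"
    and B\<^sub>G B\<^sub>\<Omega> \<tau> \<beta> \<gamma> :: real
  assumes \<Theta>: "\<And>u. \<Theta> u = \<Omega> u + \<Phi> u"
    and convex_U: "convex U"
    and J: "ext_convex J" "ext_dom J \<inter> U \<noteq> {}"
    and G: "convex_on UNIV G" "\<And>u. G differentiable (at u)" "B\<^sub>G-lipschitz_on UNIV (grad G)"
    and \<Omega>_convex: "cone_convex_on C U \<Omega>" and \<Phi>_convex: "cone_convex_on C U \<Phi>"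
    and \<Omega>_diff: "\<And>u. \<Omega> differentiable (at u)"
    and \<Omega>_lip: "\<And>p. B\<^sub>\<Omega>-lipschitz_on U (grad (\<lambda>u. p \<bullet> \<Omega> u))"
    and \<Theta>_lip: "\<tau>-lipschitz_on U \<Theta>"
    and K: "strongly_convex_on \<beta> U K" "\<And>u. u \<in> U \<Longrightarrow> K differentiable (at u)"
    and \<gamma>: "\<gamma> > 0"
begin

abbreviation S where "S \<equiv> saddle_points (lagrangian G J \<Theta>) U (dual_cone C)"

abbreviation proj where "proj \<equiv> closest_point (dual_cone C)"

lemma proj_mem: "proj a \<in> dual_cone C"
  by (rule closest_point_in_set) (use dual_cone_closed_convex[of C] in auto)

lemma proj_ineq: "s \<in> dual_cone C \<Longrightarrow> (a - proj a) \<bullet> (s - proj a) \<le> 0"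
  by (intro closest_point_dot dual_cone_closed_convex)

lemma proj_nonexpansive: "norm (proj a - proj b) \<le> norm (a - b)"
  using closest_point_lipschitz[of "dual_cone C" a b] dual_cone_closed_convex[of C]
  by (auto simp: dist_norm)

text \<open>The objective of the primal subproblem without its proximal term. The extended-valued \<open>J\<close> is
  replaced by its real part, so the values are meaningful only on the effective domain.\<close>

definition linearized :: "'a \<Rightarrow> 'b \<Rightarrow> 'a \<Rightarrow> real" where
  "linearized u q v = grad G u \<bullet> v + real_of_ereal (J v)
     + q \<bullet> (frechet_derivative \<Omega> (at u) v + \<Phi> v)"

definition step :: "real \<Rightarrow> 'a \<Rightarrow> 'b \<Rightarrow> 'a \<Rightarrow> 'b \<Rightarrow> bool" where
  "step e u p u' p' \<longleftrightarrow> u \<in> U \<and>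
     is_arg_min (\<lambda>v. ereal (grad G u \<bullet> v) + J v
         + ereal (proj (p + \<gamma> *\<^sub>R \<Theta> u) \<bullet> (frechet_derivative \<Omega> (at u) v + \<Phi> v))
         + ereal (1 / e * bregman K v u)) (\<lambda>v. v \<in> U) u' \<and>
     p' = proj (p + \<gamma> *\<^sub>R \<Theta> u')"

lemma step_primal_mem:
  assumes "step e u p u' p'"
  shows "u' \<in> U" "u' \<in> ext_dom J"
proof -
  let ?q = "proj (p + \<gamma> *\<^sub>R \<Theta> u)"
  let ?f = "\<lambda>v. ereal (grad G u \<bullet> v) + J v
         + ereal (?q \<bullet> (frechet_derivative \<Omega> (at u) v + \<Phi> v)) + ereal (1 / e * bregman K v u)"
  show u': "u' \<in> U"
    using assms by (simp add: step_def is_arg_min_def)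
  obtain v where v: "v \<in> U" "v \<in> ext_dom J"
    using J(2) by blast
  have le: "?f u' \<le> ?f v"
    using assms v by (auto simp: step_def is_arg_min_def not_less)
  have "?f v < \<infinity>"
    by (subst ext_convex_finite[OF J(1) v(2)]) simp
  with le have "?f u' < \<infinity>"
    by (rule le_less_trans)
  then show "u' \<in> ext_dom J"
    by (auto simp: ext_dom_def)
qed

lemma step_variational_ineq:
  fixes p :: 'b
  assumes st: "step e u p u' p'" and v: "v \<in> U" "v \<in> ext_dom J"
  defines "q \<equiv> proj (p + \<gamma> *\<^sub>R \<Theta> u)"
  shows "0 \<le> linearized u q v - linearized u q u' + 1 / e * ((grad K u' - grad K u) \<bullet> (v - u'))"
proof -
  let ?D = "U \<inter> ext_dom J"
  let ?\<Omega>' = "frechet_derivative \<Omega> (at u)"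
  note u' = step_primal_mem[OF st]
  have convex_D: "convex ?D"
    using convex_U convex_on_imp_convex[OF ext_convex_imp_convex_on[OF J(1)]]
    by (rule convex_Int)
  interpret \<Omega>': linear ?\<Omega>'
    using \<Omega>_diff[of u] by (rule linear_frechet_derivative)
  have lin: "convex_on ?D (\<lambda>v. grad G u \<bullet> v + q \<bullet> ?\<Omega>' v)"
    by (rule convex_onI[OF _ convex_D])
      (simp add: \<Omega>'.add \<Omega>'.scale inner_add_right distrib_left)
  have \<Phi>': "convex_on ?D (\<lambda>v. q \<bullet> \<Phi> v)"
    unfolding q_def
    by (rule convex_on_subset[OF cone_convex_on_imp_convex_on[OF \<Phi>_convex convex_U proj_mem]
          _ convex_D]) auto
  have J': "convex_on ?D (\<lambda>v. real_of_ereal (J v))"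
    by (rule convex_on_subset[OF ext_convex_imp_convex_on[OF J(1)] _ convex_D]) auto
  have "convex_on ?D (linearized u q)"
    using convex_on_add[OF convex_on_add[OF lin \<Phi>'] J']
    by (simp add: linearized_def[abs_def] inner_add_right algebra_simps)
  moreover have "GDERIV (\<lambda>v. c * bregman K v u) u' :> c *\<^sub>R (grad K u' - grad K u)" for c
  proof -
    have "(K has_derivative (\<lambda>h. h \<bullet> grad K u')) (at u')"
      using gderiv_grad[OF K(2)[OF u'(1)]] by (simp add: gderiv_def)
    then show ?thesis
      unfolding gderiv_def bregman_def
      by (auto intro!: derivative_eq_intros simp: inner_diff_right inner_commute algebra_simps)
  qed
  ultimately have "0 \<le> linearized u q v - linearized u q u'
      + ((1 / e) *\<^sub>R (grad K u' - grad K u)) \<bullet> (v - u')"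
  proof (rule composite_minimizer_variational_ineq)
    fix y assume y: "y \<in> ?D"
    have eq: "ereal (grad G u \<bullet> x) + J x + ereal (q \<bullet> (?\<Omega>' x + \<Phi> x)) + ereal (1 / e * bregman K x u)
        = ereal (linearized u q x + 1 / e * bregman K x u)" if "x \<in> ext_dom J" for x
      by (subst ext_convex_finite[OF J(1) that]) (simp add: linearized_def)
    have "ereal (grad G u \<bullet> u') + J u' + ereal (q \<bullet> (?\<Omega>' u' + \<Phi> u')) + ereal (1 / e * bregman K u' u)
       \<le> ereal (grad G u \<bullet> y) + J y + ereal (q \<bullet> (?\<Omega>' y + \<Phi> y)) + ereal (1 / e * bregman K y u)"
      using st y by (auto simp: step_def is_arg_min_def not_less q_def)
    then show "linearized u q u' + 1 / e * bregman K u' u \<le> linearized u q y + 1 / e * bregman K y u"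
      using eq[OF u'(2)] eq[of y] y by simp
  qed (use u' v in auto)
  then show ?thesis by simp
qed

lemma linearized_diff:
  "linearized u q v - linearized u q x = grad G u \<bullet> (v - x) + grad (\<lambda>u. q \<bullet> \<Omega> u) u \<bullet> (v - x)
     + (real_of_ereal (J v) - real_of_ereal (J x)) + (q \<bullet> \<Phi> v - q \<bullet> \<Phi> x)"
  by (simp add: linearized_def inner_diff_right inner_add_right grad_inner_comp(2)[OF \<Omega>_diff])

text \<open>The linearizations of \<open>G\<close> and \<open>\<lambda>u. q \<bullet> \<Omega> u\<close> at \<open>u\<close> do not exceed these functions at \<open>v\<close>, by
  convexity, and fall short of them at \<open>x\<close> by at most a quadratic error, by the descent lemma. Convexity of the second function is where
  \<open>q\<close> has to lie in the dual cone.\<close>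

lemma linearized_model_bound:
  assumes q: "q \<in> dual_cone C" and uvx: "u \<in> U" "v \<in> U" "x \<in> U"
  shows "linearized u q v - linearized u q x
    \<le> (G v + real_of_ereal (J v) + q \<bullet> \<Theta> v) - (G x + real_of_ereal (J x) + q \<bullet> \<Theta> x)
      + (B\<^sub>G + B\<^sub>\<Omega>) / 2 * (norm (x - u))\<^sup>2"
proof -
  let ?f = "\<lambda>u. q \<bullet> \<Omega> u"
  have f_diff: "?f differentiable (at z)" for z
    using grad_inner_comp(1)[OF \<Omega>_diff] by (auto simp: gderiv_def differentiable_def)
  have "grad G u \<bullet> (v - u) \<le> G v - G u"
    by (rule convex_on_gradient_ineq[OF G(1) gderiv_grad[OF G(2)]]) auto
  moreover have "G x \<le> G u + grad G u \<bullet> (x - u) + B\<^sub>G / 2 * (norm (x - u))\<^sup>2"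
    by (rule lipschitz_gradient_upper_bound[OF _ _ G(3)]) (auto intro: G(2))
  moreover have "grad ?f u \<bullet> (v - u) \<le> ?f v - ?f u"
    by (rule convex_on_gradient_ineq[OF cone_convex_on_imp_convex_on[OF \<Omega>_convex convex_U q]
          gderiv_grad[OF f_diff]]) (use uvx in auto)
  moreover have "?f x \<le> ?f u + grad ?f u \<bullet> (x - u) + B\<^sub>\<Omega> / 2 * (norm (x - u))\<^sup>2"
    by (rule lipschitz_gradient_upper_bound[OF convex_U _ \<Omega>_lip]) (use uvx f_diff in auto)
  ultimately show ?thesis
    unfolding linearized_diff \<Theta> by (simp add: inner_diff_right inner_add_right algebra_simps add_divide_distrib)
qed

text \<open>The projection \<open>p'\<close> is tested against \<open>s\<close>, and the projection \<open>q\<close> against \<open>p'\<close>. The second test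
  involves \<open>\<Theta> u\<close> instead of \<open>\<Theta> u'\<close>; the discrepancy \<open>2 * (d \<bullet> (p' - q))\<close>, with
  \<open>d = \<gamma> *\<^sub>R (\<Theta> u' - \<Theta> u)\<close>, is absorbed by the term
  \<open>(norm (p' - q))\<^sup>2\<close> at the price of \<open>(norm d)\<^sup>2\<close>.\<close>

lemma dual_step_bound:
  fixes p :: 'b
  assumes s: "s \<in> dual_cone C" and uu': "u \<in> U" "u' \<in> U"
  defines "q \<equiv> proj (p + \<gamma> *\<^sub>R \<Theta> u)" and "p' \<equiv> proj (p + \<gamma> *\<^sub>R \<Theta> u')"
  shows "2 * \<gamma> * ((s - q) \<bullet> \<Theta> u') \<le> (norm (p - s))\<^sup>2 - (norm (p' - s))\<^sup>2 - (norm (q - p))\<^sup>2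
      + (\<gamma> * \<tau> * norm (u' - u))\<^sup>2"
proof -
  define d where "d = \<gamma> *\<^sub>R (\<Theta> u' - \<Theta> u)"
  have "norm d \<le> \<gamma> * (\<tau> * norm (u' - u))"
    unfolding d_def using lipschitz_onD[OF \<Theta>_lip uu'(2,1)] \<gamma> by (simp add: dist_norm)
  then have d: "d \<bullet> d \<le> (\<gamma> * \<tau> * norm (u' - u))\<^sup>2"
    by (metis dot_square_norm norm_ge_zero power_mono mult.assoc)
  have 1: "(p + \<gamma> *\<^sub>R \<Theta> u' - p') \<bullet> (s - p') \<le> 0"
    unfolding p'_def by (rule proj_ineq[OF s])
  have 2: "(p + \<gamma> *\<^sub>R \<Theta> u - q) \<bullet> (p' - q) \<le> 0"
    unfolding q_def p'_def by (rule proj_ineq[OF proj_mem])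
  have 3: "0 \<le> (d - (p' - q)) \<bullet> (d - (p' - q))"
    by simp
  have g: "\<gamma> *\<^sub>R \<Theta> u' = \<gamma> *\<^sub>R \<Theta> u + d"
    by (simp add: d_def algebra_simps)
  have "2 * \<gamma> * ((s - q) \<bullet> \<Theta> u') = 2 * ((s - q) \<bullet> (\<gamma> *\<^sub>R \<Theta> u'))"
    by simp
  also have "\<dots> \<le> (p - s) \<bullet> (p - s) - (p' - s) \<bullet> (p' - s) - (q - p) \<bullet> (q - p) + d \<bullet> d"
    using 1 2 3 unfolding g
    by (simp add: inner_diff_right inner_diff_left inner_add_right inner_add_left inner_commute algebra_simps)
  finally show ?thesis
    using d by (simp add: dot_square_norm)
qed

text \<open>The Bregman distance is not symmetric. The reference point \<open>s\<close> takes its first place because the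
  three-point identity, applied to the optimality condition tested at \<open>s\<close>, produces the terms in this order.\<close>

definition energy :: "real \<Rightarrow> 'a \<times> 'b \<Rightarrow> 'a \<times> 'b \<Rightarrow> real" where
  "energy e w s = bregman K (fst s) (fst w) + e / (2 * \<gamma>) * (norm (snd w - snd s))\<^sup>2"

text \<open>The subproblem is optimal at \<open>u'\<close>, so testing it at \<open>us\<close> is what compares the new iterate with the
  saddle point. Multiplying the resulting inequality by \<open>e\<close> gives the Bregman terms weight one and
  the dual terms weight \<open>e / (2 * \<gamma>)\<close>; this dictates the form of the energy.\<close>

lemma energy_descent:
  assumes st: "step e u p u' p'" and s: "s \<in> S" and e: "e > 0"
  shows "energy e (u', p') s \<le> energy e (u, p) s
    - (\<beta> - e * (B\<^sub>G + B\<^sub>\<Omega> + \<gamma> * \<tau>\<^sup>2)) / 2 * (norm (u' - u))\<^sup>2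
    - e / (2 * \<gamma>) * (norm (proj (p + \<gamma> *\<^sub>R \<Theta> u) - p))\<^sup>2"
proof -
  obtain us ps where s_eq: "s = (us, ps)"
    by (cases s)
  define q where "q = proj (p + \<gamma> *\<^sub>R \<Theta> u)"
  let ?F = "\<lambda>v. G v + real_of_ereal (J v)"
  have us: "us \<in> U" "us \<in> ext_dom J" and ps: "ps \<in> dual_cone C"
    and sadp: "\<And>r. r \<in> dual_cone C \<Longrightarrow> r \<bullet> \<Theta> us \<le> ps \<bullet> \<Theta> us"
    and sadu: "\<And>v. v \<in> U \<Longrightarrow> v \<in> ext_dom J \<Longrightarrow> ?F us + ps \<bullet> \<Theta> us \<le> ?F v + ps \<bullet> \<Theta> v"
    using s unfolding s_eq saddle_points_lagrangian_iff[OF J] by auto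
  note u' = step_primal_mem[OF st]
  have u: "u \<in> U" and p': "p' = proj (p + \<gamma> *\<^sub>R \<Theta> u')"
    using st by (auto simp: step_def)
  have q: "q \<in> dual_cone C"
    unfolding q_def by (rule proj_mem)
  let ?d = "bregman K us u - bregman K us u' - bregman K u' u"
  let ?n = "(norm (u' - u))\<^sup>2"
  have "0 \<le> linearized u q us - linearized u q u' + 1 / e * ?d"
    using step_variational_ineq[OF st us] unfolding bregman_three_point q_def .
  also have "linearized u q us - linearized u q u'
      \<le> (?F us + q \<bullet> \<Theta> us) - (?F u' + q \<bullet> \<Theta> u') + (B\<^sub>G + B\<^sub>\<Omega>) / 2 * ?n"
    by (rule linearized_model_bound[OF q u us(1) u'(1)])
  also have "(?F us + q \<bullet> \<Theta> us) - (?F u' + q \<bullet> \<Theta> u') \<le> (ps - q) \<bullet> \<Theta> u'"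
    using sadu[OF u'] sadp[OF q] by (simp add: inner_diff_left)
  finally have "0 \<le> (ps - q) \<bullet> \<Theta> u' + (B\<^sub>G + B\<^sub>\<Omega>) / 2 * ?n + 1 / e * ?d"
    by simp
  then have "0 \<le> e * ((ps - q) \<bullet> \<Theta> u' + (B\<^sub>G + B\<^sub>\<Omega>) / 2 * ?n + 1 / e * ?d)"
    using e by simp
  also have "\<dots> = e * ((ps - q) \<bullet> \<Theta> u') + e * (B\<^sub>G + B\<^sub>\<Omega>) / 2 * ?n + ?d"
    using e by (simp add: distrib_left)
  finally have A: "0 \<le> e * ((ps - q) \<bullet> \<Theta> u') + e * (B\<^sub>G + B\<^sub>\<Omega>) / 2 * ?n + ?d" .
  have "e / (2 * \<gamma>) * (2 * \<gamma> * ((ps - q) \<bullet> \<Theta> u'))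
      \<le> e / (2 * \<gamma>) * ((norm (p - ps))\<^sup>2 - (norm (p' - ps))\<^sup>2 - (norm (q - p))\<^sup>2
          + (\<gamma> * \<tau> * norm (u' - u))\<^sup>2)"
    using dual_step_bound[OF ps u u'(1), of p] e \<gamma> unfolding p' q_def
    by (intro mult_left_mono) auto
  moreover have sq: "e / (2 * \<gamma>) * (\<gamma> * \<tau> * norm (u' - u))\<^sup>2 = e * (\<gamma> * \<tau>\<^sup>2) / 2 * ?n"
    using \<gamma> by (simp add: field_simps power2_eq_square)
  moreover have "e / (2 * \<gamma>) * (2 * \<gamma> * X) = e * X" for X
    using \<gamma> by simp
  ultimately have Bd: "e * ((ps - q) \<bullet> \<Theta> u')
      \<le> e / (2 * \<gamma>) * (norm (p - ps))\<^sup>2 - e / (2 * \<gamma>) * (norm (p' - ps))\<^sup>2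
        - e / (2 * \<gamma>) * (norm (q - p))\<^sup>2 + e * (\<gamma> * \<tau>\<^sup>2) / 2 * ?n"
    by (simp add: right_diff_distrib distrib_left)
  have Kl: "\<beta> / 2 * ?n \<le> bregman K u' u"
    by (rule bregman_lower_bound[OF K(1) K(2)[OF u] u u'(1)])
  have "(\<beta> - e * (B\<^sub>G + B\<^sub>\<Omega> + \<gamma> * \<tau>\<^sup>2)) / 2 * ?n
      = \<beta> / 2 * ?n - e * (B\<^sub>G + B\<^sub>\<Omega>) / 2 * ?n - e * (\<gamma> * \<tau>\<^sup>2) / 2 * ?n"
    by (simp add: algebra_simps diff_divide_distrib add_divide_distrib)
  with A Bd Kl show ?thesis
    unfolding energy_def s_eq fst_conv snd_conv q_def[symmetric] by linarith
qed

text \<open>The gain in the preceding estimate is stated in terms of the predicted multiplier \<open>q\<close>. As the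
  projection is nonexpansive, \<open>p'\<close> differs from \<open>q\<close> by at most \<open>\<gamma> * \<tau> * norm (u' - u)\<close>, so the gain
  also controls \<open>norm (p' - p)\<close> and hence the whole step.\<close>

lemma energy_sufficient_decrease:
  assumes e: "0 < elo" "ehi * (B\<^sub>G + B\<^sub>\<Omega> + \<gamma> * \<tau>\<^sup>2) < \<beta>"
  obtains \<kappa> where "\<kappa> > 0"
    "\<And>e u p u' p' s. step e u p u' p' \<Longrightarrow> s \<in> S \<Longrightarrow> elo \<le> e \<Longrightarrow> e \<le> ehi \<Longrightarrow>
       energy e (u', p') s \<le> energy e (u, p) s - \<kappa> * (norm ((u, p) - (u', p')))\<^sup>2"
proof -
  define b where "b = B\<^sub>G + B\<^sub>\<Omega> + \<gamma> * \<tau>\<^sup>2"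
  (* The squared step is at most T * (norm (u' - u))^2 + 2 * (norm (q - p))^2, so kappa is chosen
     to make kappa * T and kappa * 2 lower bounds for the two gains. *)
  define T where "T = 1 + 2 * (\<gamma> * \<tau>)\<^sup>2"
  define \<kappa> where "\<kappa> = min ((\<beta> - ehi * b) / (2 * T)) (elo / (4 * \<gamma>))"
  have "b \<ge> 0"
    unfolding b_def using lipschitz_on_nonneg[OF G(3)] lipschitz_on_nonneg[OF \<Omega>_lip] \<gamma> by simp
  have T: "T > 0"
    unfolding T_def by (simp add: add_pos_nonneg)
  have pos: "\<kappa> > 0"
    using e T \<gamma> by (simp add: \<kappa>_def b_def)
  show thesis
  proof (rule that[OF pos])
    fix e u p u' p' s
    assume st: "step e u p u' p'" and s: "s \<in> S" and elo: "elo \<le> e" and ehi: "e \<le> ehi"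
    define q where "q = proj (p + \<gamma> *\<^sub>R \<Theta> u)"
    have u: "u \<in> U" and u': "u' \<in> U" and p': "p' = proj (p + \<gamma> *\<^sub>R \<Theta> u')"
      using st step_primal_mem[OF st] by (auto simp: step_def)
    let ?n = "norm (u' - u)" and ?m = "norm (q - p)"
    have "norm (p' - q) \<le> norm (\<gamma> *\<^sub>R (\<Theta> u' - \<Theta> u))"
      unfolding p' q_def using proj_nonexpansive[of "p + \<gamma> *\<^sub>R \<Theta> u'" "p + \<gamma> *\<^sub>R \<Theta> u"]
      by (simp add: scaleR_diff_right)
    also have "\<dots> \<le> \<gamma> * \<tau> * ?n"
      using lipschitz_onD[OF \<Theta>_lip u' u] \<gamma> by (simp add: dist_norm mult.assoc)
    finally have "norm (p' - p) \<le> \<gamma> * \<tau> * ?n + ?m"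
      using norm_triangle_ineq[of "p' - q" "q - p"] by simp
    then have "(norm (p' - p))\<^sup>2 \<le> (\<gamma> * \<tau> * ?n + ?m)\<^sup>2"
      by (intro power_mono) auto
    also have "\<dots> \<le> 2 * (\<gamma> * \<tau> * ?n)\<^sup>2 + 2 * ?m\<^sup>2"
      using sum_squares_bound[of "\<gamma> * \<tau> * ?n" ?m] by (simp add: power2_sum)
    finally have dp: "(norm (p' - p))\<^sup>2 \<le> 2 * (\<gamma> * \<tau> * ?n)\<^sup>2 + 2 * ?m\<^sup>2" .
    have "(norm ((u, p) - (u', p')))\<^sup>2 = ?n\<^sup>2 + (norm (p' - p))\<^sup>2"
      by (simp add: norm_Pair norm_minus_commute)
    with dp have "(norm ((u, p) - (u', p')))\<^sup>2 \<le> T * ?n\<^sup>2 + 2 * ?m\<^sup>2"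
      by (simp add: T_def power_mult_distrib algebra_simps)
    then have "\<kappa> * (norm ((u, p) - (u', p')))\<^sup>2 \<le> \<kappa> * (T * ?n\<^sup>2 + 2 * ?m\<^sup>2)"
      using pos by (intro mult_left_mono) auto
    also have "\<dots> = (\<kappa> * T) * ?n\<^sup>2 + (\<kappa> * 2) * ?m\<^sup>2"
      by (simp add: algebra_simps)
    also have "\<dots> \<le> (\<beta> - e * b) / 2 * ?n\<^sup>2 + e / (2 * \<gamma>) * ?m\<^sup>2"
    proof (intro add_mono mult_right_mono)
      have "\<kappa> * T \<le> (\<beta> - ehi * b) / (2 * T) * T"
        using T by (intro mult_right_mono) (auto simp: \<kappa>_def)
      also have "\<dots> = (\<beta> - ehi * b) / 2"
        using T by simp
      also have "\<dots> \<le> (\<beta> - e * b) / 2"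
        using mult_right_mono[OF ehi \<open>b \<ge> 0\<close>] by simp
      finally show "\<kappa> * T \<le> (\<beta> - e * b) / 2" .
      have "\<kappa> * 2 \<le> elo / (4 * \<gamma>) * 2"
        by (simp add: \<kappa>_def)
      also have "\<dots> \<le> e / (2 * \<gamma>)"
        using elo \<gamma> by (simp add: field_simps)
      finally show "\<kappa> * 2 \<le> e / (2 * \<gamma>)" .
    qed auto
    finally show "energy e (u', p') s \<le> energy e (u, p) s - \<kappa> * (norm ((u, p) - (u', p')))\<^sup>2"
      using energy_descent[OF st s] e(1) elo unfolding b_def q_def by fastforce
  qed
qed

text \<open>At a stationary iteration the predictor \<open>q\<close> equals \<open>p\<close> and the proximal term has zero gradient. The
  optimality condition then is the primal saddle inequality for the linearized problem, which implies the one
  for the Lagrangian by convexity, and \<open>p = proj (p + \<gamma> *\<^sub>R \<Theta> u)\<close> is the dual saddle inequality.\<close>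

lemma fixed_point_imp_saddle:
  assumes st: "step e u p u p"
  shows "(u, p) \<in> S"
  unfolding saddle_points_lagrangian_iff[OF J]
proof (intro conjI ballI)
  have p: "p = proj (p + \<gamma> *\<^sub>R \<Theta> u)"
    using st by (simp add: step_def)
  show "u \<in> U \<inter> ext_dom J"
    using step_primal_mem[OF st] by simp
  show pC: "p \<in> dual_cone C"
    by (subst p) (rule proj_mem)
  show "s \<bullet> \<Theta> u \<le> p \<bullet> \<Theta> u" if s: "s \<in> dual_cone C" for s
  proof -
    have "(p + \<gamma> *\<^sub>R \<Theta> u - p) \<bullet> (s - p) \<le> 0"
      using proj_ineq[OF s, of "p + \<gamma> *\<^sub>R \<Theta> u"] p[symmetric] by simp
    then show ?thesis
      using \<gamma> by (simp add: inner_diff_right inner_commute mult_le_0_iff)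
  qed
  fix v assume v: "v \<in> U \<inter> ext_dom J"
  have "0 \<le> linearized u p v - linearized u p u"
    using step_variational_ineq[OF st, of v] v p[symmetric] by simp
  also have "\<dots> \<le> (G v + real_of_ereal (J v) + p \<bullet> \<Theta> v) - (G u + real_of_ereal (J u) + p \<bullet> \<Theta> u)"
    using linearized_model_bound[OF pC _ _ _, of u v u] v step_primal_mem[OF st] by simp
  finally show "G u + real_of_ereal (J u) + p \<bullet> \<Theta> u \<le> G v + real_of_ereal (J v) + p \<bullet> \<Theta> v"
    by simp
qed

lemma energy_nonneg:
  assumes "fst w \<in> U" "s \<in> S" "\<beta> > 0" "e \<ge> 0"
  shows "0 \<le> energy e w s"
proof -
  have "fst s \<in> U"
    using assms(2) by (auto simp: saddle_points_def)
  from bregman_lower_bound[OF K(1) K(2)[OF assms(1)] assms(1) this]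
  have "0 \<le> bregman K (fst s) (fst w)"
    using assms(3) by (smt (verit) mult_nonneg_nonneg zero_le_power2 divide_nonneg_nonneg)
  then show ?thesis
    using assms(4) \<gamma> by (simp add: energy_def)
qed

lemma bregman_dist_eq: "bregman_dist K \<gamma> e w S = (INF s\<in>S. sqrt (energy e w s))"
  by (simp add: bregman_dist_def energy_def case_prod_beta)

text \<open>The next two lemmas express that the squared infimum of the square roots is the infimum of the
  energies, in the form of its two defining properties, so that estimates valid for each saddle point pass
  to the distance.\<close>

lemma bregman_dist_sq_le:
  assumes w: "fst w \<in> U" and e: "e \<ge> 0" and \<beta>: "\<beta> > 0" and s: "s \<in> S"
  shows "(bregman_dist K \<gamma> e w S)\<^sup>2 \<le> energy e w s"
proof -
  have nonneg: "0 \<le> sqrt (energy e w t)" if "t \<in> S" for t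
    using energy_nonneg[OF w that \<beta> e] by simp
  have "bregman_dist K \<gamma> e w S \<le> sqrt (energy e w s)"
    unfolding bregman_dist_eq by (rule cINF_lower[OF _ s]) (rule bdd_belowI2[OF nonneg])
  moreover have "0 \<le> bregman_dist K \<gamma> e w S"
    unfolding bregman_dist_eq using s nonneg by (intro cINF_greatest) auto
  ultimately have "(bregman_dist K \<gamma> e w S)\<^sup>2 \<le> (sqrt (energy e w s))\<^sup>2"
    by (rule power_mono)
  with energy_nonneg[OF w s \<beta> e] show ?thesis by simp
qed

lemma le_bregman_dist_sq:
  assumes ne: "S \<noteq> {}" and c: "\<And>s. s \<in> S \<Longrightarrow> c \<le> energy e w s"
  shows "c \<le> (bregman_dist K \<gamma> e w S)\<^sup>2"
proof (cases "c \<le> 0")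
  case True
  then show ?thesis by (meson order_trans zero_le_power2)
next
  case False
  have "sqrt c \<le> bregman_dist K \<gamma> e w S"
    unfolding bregman_dist_eq using c by (intro cINF_greatest[OF ne]) simp
  then have "(sqrt c)\<^sup>2 \<le> (bregman_dist K \<gamma> e w S)\<^sup>2"
    using False by (intro power_mono) auto
  then show ?thesis using False by simp
qed

text \<open>The descent lemma for \<open>K\<close> bounds the Bregman term by a multiple of the squared norm, which makes the
  Bregman distance accessible to an error bound in the Euclidean distance.\<close>

lemma bregman_dist_sq_le_infdist:
  assumes w: "fst w \<in> U" and e: "0 \<le> e" and \<beta>: "\<beta> > 0" and ne: "S \<noteq> {}"
    and lip: "B-lipschitz_on U (grad K)" and M: "B / 2 \<le> M" "e / (2 * \<gamma>) \<le> M" "M > 0"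
  shows "(bregman_dist K \<gamma> e w S)\<^sup>2 \<le> M * (infdist w S)\<^sup>2"
proof -
  let ?b = "bregman_dist K \<gamma> e w S"
  have "sqrt (?b\<^sup>2 / M) \<le> dist w s" if s: "s \<in> S" for s
  proof -
    have s1: "fst s \<in> U"
      using s by (auto simp: saddle_points_def)
    have "?b\<^sup>2 \<le> energy e w s"
      by (rule bregman_dist_sq_le[OF w e \<beta> s])
    also have "\<dots> \<le> B / 2 * (norm (fst w - fst s))\<^sup>2 + e / (2 * \<gamma>) * (norm (snd w - snd s))\<^sup>2"
      using lipschitz_gradient_upper_bound[OF convex_U K(2) lip w s1]
      by (simp add: energy_def bregman_def norm_minus_commute)
    also have "\<dots> \<le> M * (norm (fst w - fst s))\<^sup>2 + M * (norm (snd w - snd s))\<^sup>2"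
      by (intro add_mono mult_right_mono M) auto
    also have "\<dots> = M * (dist w s)\<^sup>2"
      by (simp add: dist_norm norm_prod_def distrib_left)
    finally have "?b\<^sup>2 / M \<le> (dist w s)\<^sup>2"
      using M(3) by (simp add: field_simps)
    then show ?thesis
      by (rule real_le_lsqrt[rotated 1]) auto
  qed
  then have "sqrt (?b\<^sup>2 / M) \<le> infdist w S"
    unfolding infdist_notempty[OF ne] by (intro cINF_greatest[OF ne])
  then have "?b\<^sup>2 / M \<le> (infdist w S)\<^sup>2"
    by (rule sqrt_le_D)
  then show ?thesis
    using M(3) by (simp add: field_simps)
qed

end

section \<open>From sufficient decrease to a uniform contraction factor\<close>

text \<open>Where the bound \<open>a (Suc k) \<le> M * r k\<close> holds, \<open>\<kappa> * a (Suc k) \<le> M * (a k - a (Suc k))\<close>, so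
  \<open>M / (M + \<kappa>)\<close> is a contraction factor. For the finitely many remaining indices the decrease is strict
  unless \<open>a k = 0\<close>, and the largest ratio is still below \<open>1\<close>.\<close>

lemma uniform_contraction_factor:
  fixes a r :: "nat \<Rightarrow> real"
  assumes nonneg: "\<And>k. a k \<ge> 0" "\<And>k. r k \<ge> 0" and pos: "\<kappa> > 0" "M > 0"
    and decrease: "\<And>k. a (Suc k) \<le> a k - \<kappa> * r k"
    and bound: "\<forall>\<^sub>F k in sequentially. a (Suc k) \<le> M * r k"
    and stop: "\<And>k. r k = 0 \<Longrightarrow> a k = 0"
  shows "\<exists>\<theta>. 0 < \<theta> \<and> \<theta> < 1 \<and> (\<forall>k. a (Suc k) \<le> \<theta> * a k)"
proof -
  obtain N where N: "\<And>k. k \<ge> N \<Longrightarrow> a (Suc k) \<le> M * r k"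
    using bound by (auto simp: eventually_sequentially)
  (* Where a k = 0, also a (Suc k) = 0, and any ratio below 1 will do. *)
  define ratio where "ratio k = (if a k = 0 then 0 else a (Suc k) / a k)" for k
  have ratio: "ratio k < 1" "a (Suc k) \<le> ratio k * a k" for k
  proof -
    have "a k = 0 \<or> a (Suc k) < a k"
    proof (cases "r k = 0")
      case True
      then show ?thesis using stop by blast
    next
      case False
      then have "0 < \<kappa> * r k"
        using pos(1) nonneg(2)[of k] by simp
      with decrease[of k] show ?thesis by linarith
    qed
    then show "ratio k < 1"
      using nonneg(1)[of k] by (auto simp: ratio_def divide_less_eq)
    have "a (Suc k) \<le> a k"
      using decrease[of k] mult_nonneg_nonneg[OF less_imp_le[OF pos(1)] nonneg(2)[of k]] by linarith
    then show "a (Suc k) \<le> ratio k * a k"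
      by (auto simp: ratio_def)
  qed
  define \<theta>\<^sub>0 where "\<theta>\<^sub>0 = M / (M + \<kappa>)"
  have tail: "a (Suc k) \<le> \<theta>\<^sub>0 * a k" if "k \<ge> N" for k
  proof -
    have "\<kappa> * a (Suc k) \<le> M * (\<kappa> * r k)"
      using N[OF that] pos by (simp add: mult.left_commute)
    also have "\<dots> \<le> M * (a k - a (Suc k))"
      using decrease[of k] pos by (intro mult_left_mono) auto
    finally show ?thesis
      using pos by (simp add: \<theta>\<^sub>0_def field_simps)
  qed
  define \<theta> where "\<theta> = Max (insert \<theta>\<^sub>0 (ratio ` {..<N}))"
  have le: "\<theta>\<^sub>0 \<le> \<theta>" "\<And>k. k < N \<Longrightarrow> ratio k \<le> \<theta>"
    unfolding \<theta>_def by (auto intro!: Max_ge)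
  have "0 < \<theta>"
    using le(1) pos by (intro less_le_trans[OF _ le(1)]) (simp add: \<theta>\<^sub>0_def)
  moreover have "\<theta> < 1"
    unfolding \<theta>_def using pos ratio(1) by (auto simp: \<theta>\<^sub>0_def)
  moreover have "a (Suc k) \<le> \<theta> * a k" for k
  proof (cases "k < N")
    case True
    then show ?thesis
      using ratio(2)[of k] mult_right_mono[OF le(2) nonneg(1)[of k]] by (meson order_trans)
  next
    case False
    then show ?thesis
      using tail[of k] mult_right_mono[OF le(1) nonneg(1)[of k]] by linarith
  qed
  ultimately show ?thesis by blast
qed

theorem theorem6:
  fixes U :: "'a::euclidean_space set" and C :: "'b::euclidean_space set"
    and G K :: "'a \<Rightarrow> real" and J :: "'a \<Rightarrow> ereal"
    and \<Omega> \<Phi> \<Theta> :: "'a \<Rightarrow> 'b"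
    and B\<^sub>G B\<^sub>\<Omega> \<tau> \<beta> B \<gamma> \<epsilon>lo \<epsilon>hi c\<^sub>1 \<eta> :: real
    and \<epsilon> :: "nat \<Rightarrow> real" and w :: "nat \<Rightarrow> 'a \<times> 'b"
    and wstar :: "'a \<times> 'b" and S :: "('a \<times> 'b) set"
  defines "\<Theta> \<equiv> (\<lambda>u. \<Omega> u + \<Phi> u)"
    and "S \<equiv> saddle_points (lagrangian G J \<Theta>) U (dual_cone C)"
  assumes U: "U \<noteq> {}" "closed U" "convex U"
    and C: "C \<noteq> {}" "closed C" "convex C" "cone C"
    and H1: "ext_convex J" "lower_semicontinuous J" "ext_dom J \<inter> U \<noteq> {}"
    and H2: "convex_on UNIV G" "\<forall>u. G differentiable (at u)" "B\<^sub>G-lipschitz_on UNIV (grad G)"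
    and H3: "cone_convex_on C U \<Omega>" "cone_convex_on C U \<Phi>"
    and H4: "\<forall>u. \<Omega> differentiable (at u)"
      "\<forall>p. B\<^sub>\<Omega>-lipschitz_on U (grad (\<lambda>u. p \<bullet> \<Omega> u))"
    and H5: "\<exists>V. open V \<and> U \<subseteq> V \<and> \<tau>-lipschitz_on V \<Theta>"
    and H6: "interior C \<noteq> {} \<longrightarrow> \<Theta> ` U \<inter> uminus ` interior C \<noteq> {}"
      "C = {0} \<longrightarrow> 0 \<in> interior (\<Theta> ` U)"
    and H7: "S \<noteq> {}"
    and K: "\<beta> > 0" "strongly_convex_on \<beta> U K" "\<forall>u\<in>U. K differentiable (at u)"
      "B-lipschitz_on U (grad K)"
    and gamma: "\<gamma> > 0"
    and eps: "0 < \<epsilon>lo" "\<forall>k. \<epsilon>lo \<le> \<epsilon> (Suc k) \<and> \<epsilon> (Suc k) \<le> \<epsilon> k \<and> \<epsilon> k \<le> \<epsilon>hi"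
      "\<epsilon>hi * (B\<^sub>G + B\<^sub>\<Omega> + \<gamma> * \<tau>\<^sup>2) < \<beta>"
    and vapp: "vapp_sequence U C G J \<Omega> \<Phi> K \<gamma> \<epsilon> w"
    and conv: "w \<longlonglongrightarrow> wstar" "wstar \<in> S"
    and error_bound: "c\<^sub>1 > 0" "\<eta> > 0"
      "\<forall>k. norm (w (Suc k) - wstar) \<le> \<eta> \<longrightarrow>
           infdist (w (Suc k)) S \<le> c\<^sub>1 * norm (w k - w (Suc k))"
  shows "\<exists>\<theta>. 0 < \<theta> \<and> \<theta> < 1 \<and>
    (\<forall>k. (bregman_dist K \<gamma> (\<epsilon> (Suc k)) (w (Suc k)) S)\<^sup>2
          \<le> \<theta> * (bregman_dist K \<gamma> (\<epsilon> k) (w k) S)\<^sup>2)"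
proof -
  obtain V where V: "U \<subseteq> V" "\<tau>-lipschitz_on V \<Theta>"
    using H5 by blast
  interpret P: vapp_problem U C G K J \<Omega> \<Phi> \<Theta> B\<^sub>G B\<^sub>\<Omega> \<tau> \<beta> \<gamma>
  proof
    show "\<tau>-lipschitz_on U \<Theta>"
      using V(2,1) by (rule lipschitz_on_subset)
  qed (use U H1 H2 H3 H4 K gamma in \<open>simp_all add: \<Theta>_def\<close>)
  have S_eq: "saddle_points (lagrangian G J \<Theta>) U (dual_cone C) = S"
    by (simp add: S_def)
  have w_Suc: "is_arg_min (\<lambda>v. ereal (grad G (fst (w k)) \<bullet> v) + J v
         + ereal (P.proj (snd (w k) + \<gamma> *\<^sub>R \<Theta> (fst (w k)))
             \<bullet> (frechet_derivative \<Omega> (at (fst (w k))) v + \<Phi> v))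
         + ereal (1 / \<epsilon> k * bregman K v (fst (w k)))) (\<lambda>v. v \<in> U) (fst (w (Suc k)))"
    "snd (w (Suc k)) = P.proj (snd (w k) + \<gamma> *\<^sub>R \<Theta> (fst (w (Suc k))))" for k
    using vapp unfolding vapp_sequence_def Let_def \<Theta>_def by blast+
  have w_U: "fst (w k) \<in> U" for k
  proof (cases k)
    case 0
    then show ?thesis using vapp by (auto simp: vapp_sequence_def)
  next
    case (Suc j)
    then show ?thesis using w_Suc(1)[of j] by (simp add: is_arg_min_def)
  qed
  have step: "P.step (\<epsilon> k) (fst (w k)) (snd (w k)) (fst (w (Suc k))) (snd (w (Suc k)))" for k
    unfolding P.step_def using w_Suc[of k] w_U[of k] by blast
  have eps_bounds: "\<epsilon>lo \<le> \<epsilon> k" "\<epsilon> k \<le> \<epsilon>hi" "0 < \<epsilon> k" "\<epsilon> (Suc k) \<le> \<epsilon> k" for k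
    using eps(1) spec[OF eps(2), of k] by linarith+
  obtain \<kappa> where \<kappa>: "\<kappa> > 0"
    "\<And>e u p u' p' s. P.step e u p u' p' \<Longrightarrow> s \<in> S \<Longrightarrow> \<epsilon>lo \<le> e \<Longrightarrow> e \<le> \<epsilon>hi \<Longrightarrow>
       P.energy e (u', p') s \<le> P.energy e (u, p) s - \<kappa> * (norm ((u, p) - (u', p')))\<^sup>2"
    using P.energy_sufficient_decrease[OF eps(1,3)] unfolding S_eq by blast
  define a where "a k = (bregman_dist K \<gamma> (\<epsilon> k) (w k) S)\<^sup>2" for k
  define r where "r k = (norm (w k - w (Suc k)))\<^sup>2" for k
  define M where "M = max (B / 2) (\<epsilon>hi / (2 * \<gamma>))"
  have M: "B / 2 \<le> M" "\<epsilon>hi / (2 * \<gamma>) \<le> M" "M > 0"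
    using eps_bounds[of 0] gamma by (auto simp: M_def less_max_iff_disj)
  have decrease: "a (Suc k) \<le> a k - \<kappa> * r k" for k
  proof -
    have "a (Suc k) + \<kappa> * r k \<le> P.energy (\<epsilon> k) (w k) s" if s: "s \<in> S" for s
    proof -
      have "a (Suc k) \<le> P.energy (\<epsilon> (Suc k)) (w (Suc k)) s"
        unfolding a_def
        using P.bregman_dist_sq_le[OF w_U less_imp_le[OF eps_bounds(3)] K(1)] s
        unfolding S_eq by blast
      also have "\<dots> \<le> P.energy (\<epsilon> k) (w (Suc k)) s"
        using eps_bounds(4)[of k] gamma
        by (auto simp: P.energy_def intro!: mult_right_mono divide_right_mono)
      also have "\<dots> \<le> P.energy (\<epsilon> k) (w k) s - \<kappa> * r k"
        using \<kappa>(2)[OF step s eps_bounds(1,2)] by (simp add: r_def)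
      finally show ?thesis by simp
    qed
    then have "a (Suc k) + \<kappa> * r k \<le> a k"
      using P.le_bregman_dist_sq[of "a (Suc k) + \<kappa> * r k" "\<epsilon> k" "w k"] H7
      unfolding a_def S_eq by blast
    then show ?thesis by simp
  qed
  have stop: "a k = 0" if "r k = 0" for k
  proof -
    have "w (Suc k) = w k"
      using that by (simp add: r_def)
    then have "w k \<in> S"
      using P.fixed_point_imp_saddle[of "\<epsilon> k" "fst (w k)" "snd (w k)"] step[of k]
      unfolding S_eq by simp
    then have "a k \<le> P.energy (\<epsilon> k) (w k) (w k)"
      unfolding a_def
      using P.bregman_dist_sq_le[OF w_U less_imp_le[OF eps_bounds(3)] K(1)]
      unfolding S_eq by blast
    also have "\<dots> = 0"
      by (simp add: P.energy_def)
    finally show ?thesis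
      by (simp add: a_def)
  qed
  have "(\<lambda>k. w (Suc k)) \<longlonglongrightarrow> wstar"
    using conv(1) by (rule LIMSEQ_Suc)
  then have "\<forall>\<^sub>F k in sequentially. dist (w (Suc k)) wstar < \<eta>"
    using error_bound(2) by (rule tendstoD)
  then have "\<forall>\<^sub>F k in sequentially. a (Suc k) \<le> M * c\<^sub>1\<^sup>2 * r k"
  proof eventually_elim
    case (elim k)
    then have "infdist (w (Suc k)) S \<le> c\<^sub>1 * norm (w k - w (Suc k))"
      using error_bound(3) by (simp add: dist_norm)
    then have "(infdist (w (Suc k)) S)\<^sup>2 \<le> c\<^sub>1\<^sup>2 * r k"
      unfolding r_def power_mult_distrib[symmetric] by (intro power_mono) (auto simp: infdist_nonneg)
    moreover have "\<epsilon> (Suc k) / (2 * \<gamma>) \<le> M"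
      using eps_bounds(2)[of "Suc k"] gamma by (intro order_trans[OF _ M(2)] divide_right_mono) auto
    then have "a (Suc k) \<le> M * (infdist (w (Suc k)) S)\<^sup>2"
      unfolding a_def
      using P.bregman_dist_sq_le_infdist[OF w_U less_imp_le[OF eps_bounds(3)] K(1) _ K(4) M(1) _ M(3)] H7
      unfolding S_eq by blast
    ultimately show ?case
      using M(3) by (smt (verit) mult.assoc mult_left_mono)
  qed
  from uniform_contraction_factor[OF _ _ \<kappa>(1) _ decrease this stop] M(3) error_bound(1)
  show ?thesis
    by (simp add: a_def r_def)
qed

end
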